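(* Consider the control system $\dot x=f(x,u)$ with $f:\mathbb{R}^n\times\mathbb{R}^m\to\mathbb{R}^n$ locally Lipschitz. Let $h:\mathbb{R}^n\to\mathbb{R}$ be a continuously differentiable function and $\mathcal{C}\subset\mathbb{R}^n$ a set such that $\mathcal{C}=\{x:h(x)\ge0\}$, $\partial\mathcal{C}=\{x:h(x)=0\}$, $\mathrm{Int}(\mathcal{C})=\{x:h(x)>0\}\neq\emptyset$, and suppose $0$ is a regular value of $h$. If $\mathcal{C}$ is safe for the system, then $h$ is an eCBF of $\mathcal{C}$.
   Context: $0$ is a regular value of $h$ if $\nabla h(x)\ne0$ for all $x$ with $h(x)=0$. A closed set $\mathcal{C}$ is forward invariant under $\dot x=F(x)$ if any trajectory with initial condition in $\mathcal{C}$ at time $t=0$ remains in $\mathcal{C}$ for all $t\ge0$. A closed set $\mathcal{C}$ is safe for $\dot x=f(x,u)$ if there exists a locally Lipschitz $u_{\rm sf}:\mathbb{R}^n\to\mathbb{R}^m$ such that $\mathcal{C}$ is forward invariant for $\dot x=f(x,u_{\rm sf}(x))$. A continuous function $\alpha:\mathbb{R}\times\mathbb{R}_{\ge0}\to\mathbb{R}$ is of extended class $\mathcal{K}_\infty\mathcal{K}$ if $\alpha(\cdot,s)$ is strictly increasing for all $s\ge0$, $\alpha(r,\cdot)$ is strictly increasing for all $r>0$, $\alpha(0,s)=0$ for all $s\ge0$, and $\lim_{r\to\pm\infty}\alpha(r,s)=\pm\infty$ for all $s\ge0$. A continuously differentiable function $h:\mathbb{R}^n\to\mathbb{R}$ with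 $\mathcal{C}=\{x:h(x)\ge0\}$, $\partial\mathcal{C}=\{x:h(x)=0\}$, $\mathrm{Int}(\mathcal{C})=\{x:h(x)>0\}$ is an extended control barrier function (eCBF) of $\mathcal{C}$ if there exists an extended class $\mathcal{K}_\infty\mathcal{K}$ function $\alpha$ such that for all $x\in\mathcal{C}$ there exists $u\in\mathbb{R}^m$ satisfying $\nabla h(x)^Tf(x,u)\ge-\alpha(h(x),\|x\|)$. *)

theory Defs
  imports "HOL-Analysis.Analysis"
begin

definition gradient :: "('a::euclidean_space \<Rightarrow> real) \<Rightarrow> 'a \<Rightarrow> 'a" where
  "gradient h x = (THE D. GDERIV h x :> D)"

lemma GDERIV_gradient:
  assumes "h differentiable at x"
  shows "GDERIV h x :> gradient h x"
proof -
  from assms obtain h' where h': "(h has_derivative h') (at x)"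
    by (auto simp: differentiable_def)
  then have lin: "linear h'"
    using has_derivative_linear by blast
  have "h' = (\<lambda>v. v \<bullet> adjoint h' 1)"
    using adjoint_works[OF lin, of _ 1] by (auto simp: fun_eq_iff)
  with h' have ex: "GDERIV h x :> adjoint h' 1"
    by (simp add: gderiv_def)
  have uniq: "D = E" if "GDERIV h x :> D" "GDERIV h x :> E" for D E
  proof -
    have "(\<lambda>v. v \<bullet> D) = (\<lambda>v. v \<bullet> E)"
      using that has_derivative_unique unfolding gderiv_def by blast
    then show ?thesis
      by (simp add: fun_eq_iff vector_eq_ldot)
  qed
  show ?thesis
    unfolding gradient_def by (rule theI) (rule ex, rule uniq[OF _ ex])
qed

definition continuously_differentiable :: "('a::euclidean_space \<Rightarrow> real) \<Rightarrow> bool" where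
  "continuously_differentiable h \<longleftrightarrow>
     (\<forall>x. h differentiable at x) \<and> continuous_on UNIV (gradient h)"

definition zero_regular_value :: "('a::euclidean_space \<Rightarrow> real) \<Rightarrow> bool" where
  "zero_regular_value h \<longleftrightarrow> (\<forall>x. h x = 0 \<longrightarrow> gradient h x \<noteq> 0)"

text \<open>The library notion \<^const>\<open>local_lipschitz\<close> is for time-dependent maps; the maps here are
  autonomous, so the time argument is a dummy.\<close>

definition locally_lipschitz :: "('a::metric_space \<Rightarrow> 'b::metric_space) \<Rightarrow> bool" where
  "locally_lipschitz F \<longleftrightarrow> local_lipschitz (UNIV :: real set) UNIV (\<lambda>_. F)"

lemma locally_lipschitz_iff:
  "locally_lipschitz F \<longleftrightarrow> (\<forall>x. \<exists>e>0. \<exists>L. L-lipschitz_on (cball x e) F)"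
proof -
  have "cball t e \<noteq> {}" if "e > 0" for t e :: real
    using that by simp
  then have "(\<forall>s\<in>cball t e. P) \<longleftrightarrow> P" if "e > 0" for t e :: real and P
    using that by blast
  then show ?thesis
    unfolding locally_lipschitz_def local_lipschitz_def Int_UNIV_right
    by (simp cong: conj_cong)
qed

text \<open>Solutions of an ODE may escape in finite time, so a trajectory carries its time interval
  \<open>J\<close> (any interval in the nonnegative reals that starts at 0). Forward invariance constrains every
  trajectory at all times at which it is defined, and does not itself demand that solutions be
  defined for all times.\<close>

definition trajectory :: "('a::real_normed_vector \<Rightarrow> 'a) \<Rightarrow> real set \<Rightarrow> (real \<Rightarrow> 'a) \<Rightarrow> bool" where
  "trajectory F J x \<longleftrightarrow> is_interval J \<and> 0 \<in> J \<and> J \<subseteq> {0..} \<and>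
     (\<forall>t\<in>J. (x has_vector_derivative F (x t)) (at t within J))"

definition forward_invariant :: "('a::real_normed_vector \<Rightarrow> 'a) \<Rightarrow> 'a set \<Rightarrow> bool" where
  "forward_invariant F C \<longleftrightarrow>
     (\<forall>J x. trajectory F J x \<and> x 0 \<in> C \<longrightarrow> (\<forall>t\<in>J. x t \<in> C))"

definition safe ::
  "('a::euclidean_space \<Rightarrow> 'b::euclidean_space \<Rightarrow> 'a) \<Rightarrow> 'a set \<Rightarrow> bool" where
  "safe f C \<longleftrightarrow>
     (\<exists>u\<^sub>s\<^sub>f. locally_lipschitz u\<^sub>s\<^sub>f \<and> forward_invariant (\<lambda>x. f x (u\<^sub>s\<^sub>f x)) C)"

definition extended_class_KinfK :: "(real \<Rightarrow> real \<Rightarrow> real) \<Rightarrow> bool" where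
  "extended_class_KinfK \<alpha> \<longleftrightarrow>
     continuous_on (UNIV \<times> {0..}) (\<lambda>(r, s). \<alpha> r s) \<and>
     (\<forall>s\<ge>0. strict_mono (\<lambda>r. \<alpha> r s)) \<and>
     (\<forall>r>0. strict_mono_on {0..} (\<alpha> r)) \<and>
     (\<forall>s\<ge>0. \<alpha> 0 s = 0) \<and>
     (\<forall>s\<ge>0. filterlim (\<lambda>r. \<alpha> r s) at_top at_top \<and> filterlim (\<lambda>r. \<alpha> r s) at_bot at_bot)"

definition eCBF ::
  "('a::euclidean_space \<Rightarrow> 'b::euclidean_space \<Rightarrow> 'a) \<Rightarrow> 'a set \<Rightarrow> ('a \<Rightarrow> real) \<Rightarrow> bool" where
  "eCBF f C h \<longleftrightarrow>
     continuously_differentiable h \<and>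
     C = {x. h x \<ge> 0} \<and> frontier C = {x. h x = 0} \<and> interior C = {x. h x > 0} \<and>
     (\<exists>\<alpha>. extended_class_KinfK \<alpha> \<and>
        (\<forall>x\<in>C. \<exists>u. gradient h x \<bullet> f x u \<ge> - \<alpha> (h x) (norm x)))"

end

theory Submission
  imports Defs
begin

text \<open>
  Close the loop with the safe feedback \<open>u\<close> and write \<open>V x = gradient h x \<bullet> f x (u x)\<close> for the
  derivative of \<open>h\<close> along the closed-loop field. Two facts give the theorem.

  On the zero set of \<open>h\<close> one has \<open>V \<ge> 0\<close> (\<open>forward_invariant_boundary_nonneg\<close>): through each
  boundary point there is a trajectory, it stays where \<open>h \<ge> 0\<close>, and it starts at \<open>h = 0\<close>, so \<open>h\<close>
  cannot have a negative derivative along it at time 0. The trajectory comes from the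
  Picard-Lindeloef theorem (\<open>locally_lipschitz_trajectory\<close>), proved by Banach's fixed point theorem
  for the Picard operator.

  A continuous function \<open>w\<close>, here \<open>-V\<close>, that is nonpositive where \<open>h\<close> vanishes is bounded on
  \<open>h \<ge> 0\<close> by \<open>\<alpha> (h x) (norm x)\<close> for some \<open>\<alpha>\<close> of extended class K-infinity-K
  (\<open>KinfK_majorant\<close>). The naive candidate, the supremum of \<open>max 0 (w x)\<close> over the points
  \<open>x\<close> with \<open>0 \<le> h x \<le> r\<close> and \<open>norm x \<le> s\<close>, is monotone in both arguments but may jump. Replacing the
  sharp cutoff \<open>h x \<le> r\<close> by the factor \<open>min 1 (r / h x)\<close> makes the integrand jointly continuous:
  the factor is singular only at \<open>h x = 0\<close>, and there \<open>max 0 (w x)\<close> vanishes. Parametrising the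
  ball of radius \<open>s\<close> as \<open>s\<close> times the unit ball turns the rest into a supremum over a fixed
  compact set, which preserves continuity.
\<close>

section \<open>Local existence of trajectories\<close>

lemma globally_lipschitz_solution:
  fixes G :: "'a::euclidean_space \<Rightarrow> 'a"
  assumes lip: "L-lipschitz_on UNIV G"
  obtains T y where "T > 0" "y 0 = x0"
    "\<And>t. t \<in> {0..T} \<Longrightarrow> (y has_vector_derivative G (y t)) (at t within {0..T})"
proof -
  have L: "L \<ge> 0" using lip by (rule lipschitz_on_nonneg)
  have contG: "continuous_on UNIV G" using lip by (rule lipschitz_on_continuous_on)
  \<comment> \<open>Short enough for the Picard operator to be a contraction.\<close>
  define T where "T = 1 / (2 * (L + 1))"
  have T: "T > 0" and LT: "L * T \<le> 1/2" using L by (auto simp: T_def field_simps)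
  \<comment> \<open>Freezing time outside \<open>{0..T}\<close> keeps the operator inside the complete space of bounded
    continuous functions on the whole line.\<close>
  define clip where "clip t = max 0 (min T t)" for t :: real
  have clip_in: "clip t \<in> {0..T}" for t using T by (auto simp: clip_def)
  have clip_cont: "continuous_on UNIV clip"
    unfolding clip_def by (intro continuous_intros)
  define pic where "pic y t = x0 + integral {0..clip t} (\<lambda>s. G (apply_bcontfun y s))"
    for y :: "real \<Rightarrow>\<^sub>C 'a" and t
  have contGy: "continuous_on S (\<lambda>s. G (apply_bcontfun y s))" for y :: "real \<Rightarrow>\<^sub>C 'a" and S
    by (rule continuous_on_compose2[OF contG]) auto
  have cont_int: "continuous_on {0..T} (\<lambda>t. x0 + integral {0..t} (\<lambda>s. G (apply_bcontfun y s)))"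
    for y :: "real \<Rightarrow>\<^sub>C 'a"
    by (intro continuous_intros indefinite_integral_continuous_1 integrable_continuous_real contGy)
  have pic_mem: "pic y \<in> bcontfun" for y
  proof -
    have "continuous_on UNIV (pic y)"
      unfolding pic_def
      by (rule continuous_on_compose2[OF cont_int clip_cont]) (use clip_in in auto)
    moreover have "range (pic y) \<subseteq> (\<lambda>t. x0 + integral {0..t} (\<lambda>s. G (apply_bcontfun y s))) ` {0..T}"
      using clip_in by (auto simp: pic_def)
    then have "bounded (range (pic y))"
      using compact_imp_bounded[OF compact_continuous_image[OF cont_int compact_Icc]]
        bounded_subset by blast
    ultimately show ?thesis by (simp add: bcontfun_def)
  qed
  define P where "P y = Bcontfun (pic y)" for y
  have P: "apply_bcontfun (P y) t = pic y t" for y t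
    by (simp add: P_def Bcontfun_inverse[OF pic_mem])
  have "dist (P y) (P z) \<le> 1/2 * dist y z" for y z
  proof (rule dist_bound)
    fix t
    let ?d = "\<lambda>s. G (apply_bcontfun y s) - G (apply_bcontfun z s)"
    have "norm (?d s) \<le> L * dist y z" for s
      using lipschitz_onD[OF lip, of "apply_bcontfun y s" "apply_bcontfun z s"]
        mult_left_mono[OF dist_bounded[of y s z] L] by (simp add: dist_norm)
    then have "norm (integral {0..clip t} ?d) \<le> L * dist y z * (clip t - 0)"
      using clip_in[of t] by (intro integral_bound continuous_on_diff contGy) auto
    also have "\<dots> \<le> L * dist y z * T"
      using clip_in[of t] L by (intro mult_left_mono) auto
    also have "\<dots> \<le> 1/2 * dist y z"
      using mult_right_mono[OF LT zero_le_dist[of y z]] by (simp add: mult_ac)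
    finally show "dist (apply_bcontfun (P y) t) (apply_bcontfun (P z) t) \<le> 1/2 * dist y z"
      by (simp add: P pic_def dist_norm
          integral_diff[OF integrable_continuous_real integrable_continuous_real, OF contGy contGy])
  qed
  then obtain y where "P y = y"
    using banach_fix_type[of "1/2" P] by auto
  then have y: "apply_bcontfun y t = x0 + integral {0..clip t} (\<lambda>s. G (apply_bcontfun y s))" for t
    using P[of y t] by (simp add: pic_def)
  show thesis
  proof (rule that[OF T])
    show "apply_bcontfun y 0 = x0" by (subst y) (use T in \<open>simp add: clip_def\<close>)
    fix t assume t: "t \<in> {0..T}"
    have "((\<lambda>t. x0 + integral {0..t} (\<lambda>s. G (apply_bcontfun y s)))
        has_vector_derivative 0 + G (apply_bcontfun y t)) (at t within {0..T})"
      by (intro has_vector_derivative_add has_vector_derivative_const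
          integral_has_vector_derivative contGy t)
    then show "(apply_bcontfun y has_vector_derivative G (apply_bcontfun y t)) (at t within {0..T})"
      unfolding add_0 by (rule has_vector_derivative_transform[OF t, rotated])
        (subst y, simp add: clip_def)
  qed
qed

text \<open>Composing with the nearest-point projection onto a small ball, which is 1-Lipschitz, makes
  the field globally Lipschitz without changing it near the initial point; by continuity the
  solution of the modified equation stays in the ball for a short time.\<close>

lemma locally_lipschitz_trajectory:
  fixes F :: "'a::euclidean_space \<Rightarrow> 'a"
  assumes "locally_lipschitz F"
  obtains T x where "T > 0" "x 0 = x0" "trajectory F {0..T} x"
proof -
  obtain e L where e: "e > 0" and lip: "L-lipschitz_on (cball x0 e) F"
    using assms unfolding locally_lipschitz_iff by blast
  define p where "p = closest_point (cball x0 e)"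
  have ne: "cball x0 e \<noteq> {}" using e by simp
  have p_in: "p z \<in> cball x0 e" for z
    unfolding p_def by (rule closest_point_in_set[OF closed_cball ne])
  have p_id: "p z = z" if "z \<in> cball x0 e" for z
    unfolding p_def by (rule closest_point_self[OF that])
  have "1-lipschitz_on UNIV p"
    unfolding p_def
    by (intro lipschitz_onI) (simp_all add: closest_point_lipschitz[OF convex_cball closed_cball ne])
  moreover have "L-lipschitz_on (p ` UNIV) F"
    using lip by (rule lipschitz_on_subset) (use p_in in auto)
  ultimately have "(L * 1)-lipschitz_on UNIV (\<lambda>z. F (p z))"
    by (rule lipschitz_on_compose2)
  then obtain T y where T: "T > 0" and y0: "y 0 = x0"
    and y: "\<And>t. t \<in> {0..T} \<Longrightarrow> (y has_vector_derivative F (p (y t))) (at t within {0..T})"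
    by (rule globally_lipschitz_solution) blast
  have "continuous (at 0 within {0..T}) y"
    using y[of 0] T by (intro has_vector_derivative_continuous) auto
  then obtain d where d: "d > 0" "\<And>t. t \<in> {0..T} \<Longrightarrow> dist t 0 < d \<Longrightarrow> dist (y t) (y 0) < e"
    unfolding continuous_within_eps_delta using e by blast
  define T' where "T' = min T (d/2)"
  have T': "T' > 0" "{0..T'} \<subseteq> {0..T}" using T d(1) by (auto simp: T'_def)
  have "(y has_vector_derivative F (y t)) (at t within {0..T'})" if t: "t \<in> {0..T'}" for t
  proof -
    have "dist (y t) x0 < e"
      using d(2)[of t] t T'(2) d(1) y0 by (auto simp: T'_def dist_real_def)
    then have "p (y t) = y t" by (intro p_id) (simp add: dist_commute)
    then show ?thesis
      using has_vector_derivative_within_subset[OF y T'(2), of t] subsetD[OF T'(2) t] by simp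
  qed
  then have "trajectory F {0..T'} y"
    using T'(1) by (auto simp: trajectory_def is_interval_cc)
  with T'(1) y0 show thesis by (rule that)
qed

lemma locally_lipschitz_continuous:
  fixes F :: "'a::metric_space \<Rightarrow> 'b::metric_space"
  assumes "locally_lipschitz F"
  shows "continuous_on UNIV F"
proof (rule continuous_at_imp_continuous_on, intro ballI)
  fix x
  obtain e L where e: "e > 0" and lip: "L-lipschitz_on (cball x e) F"
    using assms unfolding locally_lipschitz_iff by blast
  have "x \<in> interior (cball x e)"
    using e by (intro interiorI[OF open_ball _ ball_subset_cball]) simp
  with lipschitz_on_continuous_on[OF lip] show "isCont F x"
    by (rule continuous_on_interior)
qed

text \<open>Feedback keeps the closed-loop field locally Lipschitz, because \<open>x \<mapsto> (x, u x)\<close> is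
  locally Lipschitz and hence maps a small ball into one on which \<open>f\<close> is Lipschitz.\<close>

lemma locally_lipschitz_closed_loop:
  fixes f :: "'a::metric_space \<Rightarrow> 'b::metric_space \<Rightarrow> 'c::metric_space"
  assumes f: "locally_lipschitz (\<lambda>(x, u). f x u)" and u: "locally_lipschitz u"
  shows "locally_lipschitz (\<lambda>x. f x (u x))"
  unfolding locally_lipschitz_iff
proof
  fix x
  obtain e L where e: "e > 0" and L: "L-lipschitz_on (cball (x, u x) e) (\<lambda>(x, u). f x u)"
    using f unfolding locally_lipschitz_iff by blast
  obtain d M where d: "d > 0" and M: "M-lipschitz_on (cball x d) u"
    using u unfolding locally_lipschitz_iff by blast
  define N where "N = sqrt (1\<^sup>2 + M\<^sup>2)"
  have pair: "N-lipschitz_on (cball x d) (\<lambda>y. (y, u y))"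
    unfolding N_def by (rule lipschitz_on_Pair[OF lipschitz_on_id M])
  have N: "N \<ge> 0" using pair by (rule lipschitz_on_nonneg)
  define r where "r = min d (e / (N + 1))"
  have r: "r > 0" "r \<le> d" using e d N by (auto simp: r_def)
  have "N * r \<le> N * (e / (N + 1))" using N by (intro mult_left_mono) (auto simp: r_def)
  also have "\<dots> \<le> e" using N e by (simp add: field_simps)
  finally have Nr: "N * r \<le> e" .
  have "(y, u y) \<in> cball (x, u x) e" if y: "y \<in> cball x r" for y
  proof -
    have "dist (x, u x) (y, u y) \<le> N * dist x y"
      using y r d by (intro lipschitz_onD[OF pair]) auto
    also have "\<dots> \<le> N * r" using y N by (intro mult_left_mono) auto
    finally show ?thesis using Nr by simp
  qed
  then have "L-lipschitz_on ((\<lambda>y. (y, u y)) ` cball x r) (\<lambda>(x, u). f x u)"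
    by (intro lipschitz_on_subset[OF L]) blast
  moreover have "N-lipschitz_on (cball x r) (\<lambda>y. (y, u y))"
    by (rule lipschitz_on_subset[OF pair]) (use r in auto)
  ultimately have "(L * N)-lipschitz_on (cball x r) (\<lambda>y. f y (u y))"
    using lipschitz_on_compose2 by fastforce
  with r(1) show "\<exists>e>0. \<exists>L. L-lipschitz_on (cball x e) (\<lambda>x. f x (u x))" by blast
qed

section \<open>Forward invariance at the boundary\<close>

text \<open>The necessary half of Nagumo's theorem: a negative derivative of \<open>h\<close> at the start of a
  trajectory would push it out of the set at once.\<close>

lemma forward_invariant_boundary_nonneg:
  fixes F :: "'a::euclidean_space \<Rightarrow> 'a"
  assumes F: "locally_lipschitz F" and inv: "forward_invariant F {x. h x \<ge> 0}"
    and diff: "h differentiable at x0" and x0: "h x0 = 0"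
  shows "gradient h x0 \<bullet> F x0 \<ge> 0"
proof (rule ccontr)
  assume neg: "\<not> gradient h x0 \<bullet> F x0 \<ge> 0"
  obtain T x where T: "T > 0" and x_0: "x 0 = x0" and tr: "trajectory F {0..T} x"
    using F by (rule locally_lipschitz_trajectory)
  have dx: "(x has_vector_derivative F x0) (at 0 within {0..T})"
    using tr T x_0 unfolding trajectory_def by force
  have "(h has_derivative (\<lambda>v. v \<bullet> gradient h x0)) (at (x 0))"
    using GDERIV_gradient[OF diff] by (simp add: gderiv_def x_0)
  then have "(h has_derivative (\<lambda>v. v \<bullet> gradient h x0)) (at (x 0) within x ` {0..T})"
    by (rule has_derivative_at_withinI)
  from vector_derivative_diff_chain_within[OF dx this]
  have "((\<lambda>t. h (x t)) has_real_derivative gradient h x0 \<bullet> F x0) (at 0 within {0..T})"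
    by (simp add: has_real_derivative_iff_has_vector_derivative o_def inner_commute)
  then obtain d where d: "d > 0"
    and dec: "\<And>t. t > 0 \<Longrightarrow> 0 + t \<in> {0..T} \<Longrightarrow> t < d \<Longrightarrow> h (x (0 + t)) < h (x 0)"
    using has_real_derivative_neg_dec_right[of "\<lambda>t. h (x t)"] neg not_le by blast
  define t where "t = min T (d/2)"
  have t: "t > 0" "t \<in> {0..T}" "t < d" using T d by (auto simp: t_def)
  have "h (x t) < 0" using dec[of t] t x_0 x0 by simp
  moreover have "h (x t) \<ge> 0"
    using inv tr t(2) x_0 x0 unfolding forward_invariant_def by force
  ultimately show False by simp
qed

section \<open>Majorants of extended class K-infinity-K\<close>

text \<open>Compactness of \<open>K\<close> makes \<open>g x y\<close> continuous in \<open>x\<close> uniformly over \<open>y \<in> K\<close>, and a supremum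
  moves by no more than its terms do.\<close>

lemma continuous_on_SUP_compact:
  fixes g :: "'a::topological_space \<Rightarrow> 'b::topological_space \<Rightarrow> real"
  assumes cont: "continuous_on (U \<times> K) (\<lambda>(x, y). g x y)" and K: "compact K" "K \<noteq> {}"
  shows "continuous_on U (\<lambda>x. SUP y\<in>K. g x y)"
  unfolding continuous_on_def
proof (intro ballI tendstoI)
  fix x0 and e :: real assume x0: "x0 \<in> U" and e: "e > 0"
  have bdd: "bdd_above (g x ` K)" if "x \<in> U" for x
  proof -
    have "continuous_on K (\<lambda>y. case (x, y) of (x, y) \<Rightarrow> g x y)"
      by (rule continuous_on_compose2[OF cont]) (use that in \<open>auto intro!: continuous_intros\<close>)
    then have "compact (g x ` K)"
      using K(1) by (simp add: compact_continuous_image)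
    then show ?thesis
      by (intro bounded_imp_bdd_above compact_imp_bounded)
  qed
  have e2: "e / 2 > 0" using e by simp
  obtain X where X: "x0 \<in> X" "open X"
    and close: "\<forall>x\<in>X \<inter> U. \<forall>y\<in>K. dist (case (x, y) of (x, y) \<Rightarrow> g x y) (case (x0, y) of (x, y) \<Rightarrow> g x y) \<le> e / 2"
    by (rule continuous_on_prod_compactE[OF cont K(1) x0 e2])
  have "dist (SUP y\<in>K. g x y) (SUP y\<in>K. g x0 y) < e" if x: "x \<in> X" "x \<in> U" for x
  proof -
    have c: "\<bar>g x y - g x0 y\<bar> \<le> e / 2" if "y \<in> K" for y
      using close x that by (auto simp: dist_real_def)
    have "(SUP y\<in>K. g x y) \<le> (SUP y\<in>K. g x0 y) + e / 2"
    proof (rule cSUP_least[OF K(2)])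
      fix y assume y: "y \<in> K"
      show "g x y \<le> (SUP y\<in>K. g x0 y) + e / 2"
        using c[OF y] cSUP_upper[OF y bdd[OF x0]] by linarith
    qed
    moreover have "(SUP y\<in>K. g x0 y) \<le> (SUP y\<in>K. g x y) + e / 2"
    proof (rule cSUP_least[OF K(2)])
      fix y assume y: "y \<in> K"
      show "g x0 y \<le> (SUP y\<in>K. g x y) + e / 2"
        using c[OF y] cSUP_upper[OF y bdd[OF x(2)]] by linarith
    qed
    ultimately show ?thesis using e by (simp add: dist_real_def)
  qed
  then show "\<forall>\<^sub>F x in at x0 within U. dist (SUP y\<in>K. g x y) (SUP y\<in>K. g x0 y) < e"
    using X unfolding eventually_at_topological by blast
qed

text \<open>Near a zero of \<open>h\<close> the quotient is out of control, but the cutoff factor stays in \<open>{0..1}\<close>,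
  so the product is squeezed between 0 and \<open>max 0 (w x)\<close>, which tends to 0.\<close>

lemma continuous_soft_cutoff:
  fixes h w :: "'a::t2_space \<Rightarrow> real"
  assumes h: "continuous_on UNIV h" and w: "continuous_on UNIV w"
    and zero: "\<And>x. h x = 0 \<Longrightarrow> w x \<le> 0"
  shows "continuous_on UNIV
    (\<lambda>(r, x). if h x > 0 then max 0 (w x) * min 1 (max 0 r / h x) else 0)"
    (is "continuous_on UNIV ?W")
proof (rule continuous_at_imp_continuous_on, intro ballI)
  fix q :: "real \<times> 'a"
  have hq: "continuous_on S (\<lambda>q :: real \<times> 'a. h (snd q))"
    and wq: "continuous_on S (\<lambda>q :: real \<times> 'a. w (snd q))" for S
    by (auto intro!: continuous_on_compose2[OF h] continuous_on_compose2[OF w] continuous_intros)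
  have open_pos: "open {q :: real \<times> 'a. h (snd q) > 0}"
    and open_neg: "open {q :: real \<times> 'a. h (snd q) < 0}"
    by (intro open_Collect_less hq continuous_on_const)+
  consider "h (snd q) > 0" | "h (snd q) < 0" | "h (snd q) = 0" by linarith
  then show "isCont ?W q"
  proof cases
    case 1
    have "continuous_on {q :: real \<times> 'a. h (snd q) > 0} ?W \<longleftrightarrow>
        continuous_on {q :: real \<times> 'a. h (snd q) > 0}
         (\<lambda>q. max 0 (w (snd q)) * min 1 (max 0 (fst q) / h (snd q)))"
      by (rule continuous_on_cong) auto
    moreover have "continuous_on {q :: real \<times> 'a. h (snd q) > 0}
         (\<lambda>q. max 0 (w (snd q)) * min 1 (max 0 (fst q) / h (snd q)))"
      by (intro continuous_intros hq wq) auto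
    ultimately show ?thesis
      using 1 continuous_on_eq_continuous_at[OF open_pos, of ?W] by (cases q) simp
  next
    case 2
    have "continuous_on {q :: real \<times> 'a. h (snd q) < 0} ?W \<longleftrightarrow>
        continuous_on {q :: real \<times> 'a. h (snd q) < 0} (\<lambda>q. 0 :: real)"
      by (rule continuous_on_cong) auto
    then show ?thesis
      using 2 continuous_on_eq_continuous_at[OF open_neg, of ?W] by (cases q) simp
  next
    case 3
    have "isCont (\<lambda>q. w (snd q)) q"
      using wq[of UNIV] by (cases q) (simp add: continuous_on_eq_continuous_at)
    then have "((\<lambda>q. max 0 (w (snd q))) \<longlongrightarrow> max 0 (w (snd q))) (at q)"
      unfolding isCont_def by (intro tendsto_intros)
    moreover have "max 0 (w (snd q)) = 0" using zero[OF 3] by simp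
    ultimately have lim: "((\<lambda>q. max 0 (w (snd q))) \<longlongrightarrow> 0) (at q)" by simp
    have "norm (?W p) \<le> max 0 (w (snd p))" for p
      by (auto simp: split_beta abs_mult intro!: mult_left_le)
    then have "(?W \<longlongrightarrow> 0) (at q)"
      by (intro Lim_null_comparison[OF _ lim] always_eventually) simp
    then show ?thesis using 3 by (simp add: isCont_def split_beta)
  qed
qed

text \<open>Take the supremum over the ball of radius \<open>norm x\<close> of the softly cut off \<open>w\<close>. At the level
  \<open>r = h x\<close> the cutoff factor of the point \<open>x\<close> itself is 1, so the supremum is at least \<open>w x\<close>.\<close>

lemma KinfK_majorant:
  fixes h w :: "'a::euclidean_space \<Rightarrow> real"
  assumes h: "continuous_on UNIV h" and w: "continuous_on UNIV w"
    and zero: "\<And>x. h x = 0 \<Longrightarrow> w x \<le> 0"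
  obtains \<alpha> where "extended_class_KinfK \<alpha>" "\<And>x. h x \<ge> 0 \<Longrightarrow> w x \<le> \<alpha> (h x) (norm x)"
proof -
  define W where "W r x = (if h x > 0 then max 0 (w x) * min 1 (max 0 r / h x) else 0)" for r x
  have W_cont: "continuous_on UNIV (\<lambda>(r, x). W r x)"
    unfolding W_def by (rule continuous_soft_cutoff[OF h w zero])
  have W_mono: "W r x \<le> W r' x" if "r \<le> r'" for r r' x
    using that by (auto simp: W_def intro!: mult_left_mono min.mono divide_right_mono)
  have W_0: "W r x = 0" if "r \<le> 0" for r x
    using that by (simp add: W_def max_def)
  have W_on: "w x \<le> W (h x) x" if "h x \<ge> 0" for x
    using that zero[of x] by (auto simp: W_def)
  define A where "A r s = (SUP y\<in>cball 0 1. W r (s *\<^sub>R y))" for r s :: real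
  have ne: "cball (0::'a) 1 \<noteq> {}" by simp
  have g_cont: "continuous_on S (\<lambda>(q, y). W (fst q) (snd q *\<^sub>R y))" for S :: "((real \<times> real) \<times> 'a) set"
  proof -
    have "continuous_on S (\<lambda>p. case (fst (fst p), snd (fst p) *\<^sub>R snd p) of (r, x) \<Rightarrow> W r x)"
      by (rule continuous_on_compose2[OF W_cont]) (auto intro!: continuous_intros)
    then show ?thesis by (simp add: split_beta)
  qed
  have A_cont: "continuous_on UNIV (\<lambda>q. A (fst q) (snd q))"
    unfolding A_def by (rule continuous_on_SUP_compact[OF g_cont compact_cball ne])
  have bdd: "bdd_above ((\<lambda>y. W r (s *\<^sub>R y)) ` cball 0 1)" for r s
  proof -
    have "continuous_on (cball 0 1) (\<lambda>y. case (r, s *\<^sub>R y) of (r, x) \<Rightarrow> W r x)"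
      by (rule continuous_on_compose2[OF W_cont]) (auto intro!: continuous_intros)
    then have "compact ((\<lambda>y. W r (s *\<^sub>R y)) ` cball 0 1)"
      by (intro compact_continuous_image) auto
    then show ?thesis by (intro bounded_imp_bdd_above compact_imp_bounded)
  qed
  have A_upper: "W r (s *\<^sub>R y) \<le> A r s" if "norm y \<le> 1" for r s y
    unfolding A_def using that by (intro cSUP_upper bdd) simp
  have A_mono_r: "A r s \<le> A r' s" if "r \<le> r'" for r r' s
    unfolding A_def by (rule cSUP_mono[OF ne bdd]) (use W_mono[OF that] in blast)
  have A_mono_s: "A r s \<le> A r s'" if "0 \<le> s" "s \<le> s'" for r s s'
  proof (cases "s' = 0")
    case False
    then have s': "s' > 0" using that by simp
    have "W r (s *\<^sub>R y) \<le> A r s'" if y: "y \<in> cball 0 1" for y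
    proof -
      have "norm ((s / s') *\<^sub>R y) \<le> 1"
        using mult_mono[of s s' "norm y" 1] y \<open>0 \<le> s\<close> \<open>s \<le> s'\<close> s'
        by (simp add: divide_le_eq)
      from A_upper[OF this, of r s'] show ?thesis using s' by simp
    qed
    then show ?thesis unfolding A_def[of r s] by (rule cSUP_least[OF ne])
  qed (use that in simp)
  have A_0: "A r s = 0" if "r \<le> 0" for r s
    using ne by (simp add: A_def W_0[OF that])
  have A_on: "w x \<le> A (h x) (norm x)" if "h x \<ge> 0" for x
  proof -
    have "norm (sgn x) \<le> 1" by (simp add: norm_sgn)
    moreover have "norm x *\<^sub>R sgn x = x" by (cases "x = 0") (simp_all add: sgn_div_norm)
    ultimately show ?thesis
      using W_on[OF that] A_upper[of "sgn x" "h x" "norm x"] by (metis order_trans)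
  qed
  \<comment> \<open>\<open>A\<close> is only weakly monotone and bounded in \<open>r\<close>; the summand \<open>r\<close> supplies strictness and both
    limits in the first argument, and \<open>max 0 r * s\<close> strictness in the second for \<open>r > 0\<close>.\<close>
  define \<alpha> where "\<alpha> r s = A r s + r + max 0 r * s" for r s
  have "extended_class_KinfK \<alpha>"
    unfolding extended_class_KinfK_def
  proof (intro conjI allI impI)
    show "continuous_on (UNIV \<times> {0..}) (\<lambda>(r, s). \<alpha> r s)"
      unfolding \<alpha>_def split_beta
      by (intro continuous_intros continuous_on_subset[OF A_cont]) auto
  next
    fix s :: real assume s: "s \<ge> 0"
    show "strict_mono (\<lambda>r. \<alpha> r s)"
    proof (rule strict_monoI)
      fix r r' :: real assume less: "r < r'"
      then have "max 0 r * s \<le> max 0 r' * s"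
        using s by (intro mult_right_mono) auto
      then show "\<alpha> r s < \<alpha> r' s"
        using A_mono_r[of r r' s] less by (simp add: \<alpha>_def)
    qed
    show "\<alpha> 0 s = 0" by (simp add: \<alpha>_def A_0)
    have "r \<le> \<alpha> r s" if "r \<ge> 0" for r
      using A_mono_r[of 0 r s] A_0[of 0 s] that s by (simp add: \<alpha>_def)
    then show "filterlim (\<lambda>r. \<alpha> r s) at_top at_top"
      by (intro filterlim_at_top_mono[OF filterlim_ident] eventually_at_top_linorderI[of 0])
    have "\<alpha> r s = r" if "r \<le> 0" for r using that by (simp add: \<alpha>_def A_0)
    then have "\<forall>\<^sub>F r in at_bot. \<alpha> r s = r"
      by (auto simp: eventually_at_bot_linorder)
    then show "filterlim (\<lambda>r. \<alpha> r s) at_bot at_bot"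
      using filterlim_cong[OF refl refl, of "\<lambda>r. \<alpha> r s" "\<lambda>r. r" at_bot at_bot]
      by (simp add: filterlim_ident)
  next
    fix r :: real assume "r > 0"
    then show "strict_mono_on {0..} (\<alpha> r)"
      by (auto simp: strict_mono_on_def \<alpha>_def intro!: add_le_less_mono A_mono_s)
  qed
  moreover have "w x \<le> \<alpha> (h x) (norm x)" if "h x \<ge> 0" for x
    using A_on[OF that] that by (simp add: \<alpha>_def add_increasing2)
  ultimately show thesis by (rule that)
qed

section \<open>Safe sets have extended control barrier functions\<close>

theorem mainTheorem2:
  fixes f :: "real ^ 'n \<Rightarrow> real ^ 'm \<Rightarrow> real ^ 'n"
    and h :: "real ^ 'n \<Rightarrow> real"
    and C :: "(real ^ 'n) set"
  assumes "locally_lipschitz (\<lambda>(x, u). f x u)"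
    and "continuously_differentiable h"
    and "C = {x. h x \<ge> 0}"
    and "frontier C = {x. h x = 0}"
    and "interior C = {x. h x > 0}"
    and "interior C \<noteq> {}"
    and "zero_regular_value h"
    and "safe f C"
  shows "eCBF f C h"
proof -
  obtain u where u: "locally_lipschitz u" and inv: "forward_invariant (\<lambda>x. f x (u x)) C"
    using assms(8) unfolding safe_def by blast
  define F where "F = (\<lambda>x. f x (u x))"
  have F: "locally_lipschitz F"
    unfolding F_def by (rule locally_lipschitz_closed_loop[OF assms(1) u])
  have diff: "\<And>x. h differentiable at x" and grad: "continuous_on UNIV (gradient h)"
    using assms(2) by (auto simp: continuously_differentiable_def)
  have h: "continuous_on UNIV h"
    using diff by (intro continuous_at_imp_continuous_on ballI differentiable_imp_continuous_within)
  have w: "continuous_on UNIV (\<lambda>x. - (gradient h x \<bullet> F x))"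
    by (intro continuous_intros grad locally_lipschitz_continuous F)
  have "- (gradient h x \<bullet> F x) \<le> 0" if "h x = 0" for x
    using forward_invariant_boundary_nonneg[OF F _ diff that] inv assms(3) by (simp add: F_def)
  then obtain \<alpha> where "extended_class_KinfK \<alpha>"
    and "\<And>x. h x \<ge> 0 \<Longrightarrow> - (gradient h x \<bullet> F x) \<le> \<alpha> (h x) (norm x)"
    by (rule KinfK_majorant[OF h w]) (assumption, rule that)
  then have "\<exists>\<alpha>. extended_class_KinfK \<alpha> \<and>
      (\<forall>x\<in>C. \<exists>u. gradient h x \<bullet> f x u \<ge> - \<alpha> (h x) (norm x))"
    unfolding F_def assms(3) by (metis (lifting) mem_Collect_eq minus_le_iff)
  then show ?thesis
    using assms(2-5) unfolding eCBF_def by blast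
qed

end
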